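(* Let $L$ be a finite dimensional special Heisenberg Lie superalgebra over $\mathbb{F}$ with even center. Then there are non-negative integers $m,n$ such that $L$ has dimension $(2m+1\mid n)$ and $L$ is isomorphic to $H(m,n)=H_{\bar 0}\oplus H_{\bar 1}$, where $$H_{\bar 0}=\langle x_1,\ldots,x_m,x_{m+1},\ldots,x_{2m};\, z\mid [x_i,x_{m+i}]=z,\ i=1,\ldots,m\rangle$$ and $$H_{\bar 1}=\langle y_1,\ldots,y_n\mid [y_j,y_j]=z,\ j=1,\ldots,n\rangle .$$
   Context: $\mathbb{F}$ is an algebraically closed field of characteristic zero; all Lie superalgebras are over $\mathbb{F}$ and finite dimensional. The dimension of $L=L_{\bar 0}\oplus L_{\bar 1}$ is written $(a\mid b)$ with $a=\dim L_{\bar 0}$, $b=\dim L_{\bar 1}$. $L'=[L,L]$ and $Z(L)=\{z\in L: [z,x]=0 \text{ for all } x\in L\}$. A Lie superalgebra $L$ is called special Heisenberg if $L'=Z(L)$ and $\dim L'=1$; it has even center if $Z(L)\subseteq L_{\bar 0}$. In $H(m,n)$ the elements $x_1,\dots,x_{2m},z$ form a basis of the even part, $y_1,\dots,y_n$ form a basis of the odd part, and all brackets of basis elements not listed (up to graded skew-symmetry) are zero. Isomorphisms are homogeneous of degree $0$. *)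

theory Defs
  imports
    "HOL-Computational_Algebra.Polynomial"
    "HOL-Library.Function_Algebras"
    "HOL-Library.Z2"
begin

text \<open>
  A superalgebra is a graded subspace of an ambient vector space of type \<open>'v\<close>; the grading group
  is the type \<^typ>\<open>bit\<close> of integers modulo 2. The bracket is only relevant on the subspace.
\<close>

record ('f, 'v) superalgebra =
  scl :: "'f \<Rightarrow> 'v \<Rightarrow> 'v"
  part :: "bit \<Rightarrow> 'v set"
  brk :: "'v \<Rightarrow> 'v \<Rightarrow> 'v"

definition carr :: "('f, 'v::ab_group_add) superalgebra \<Rightarrow> 'v set" where
  "carr L = {x + y | x y. x \<in> part L 0 \<and> y \<in> part L 1}"

definition koszul_sign :: "bit \<Rightarrow> bit \<Rightarrow> 'f::field" where
  "koszul_sign a b = (if a = 1 \<and> b = 1 then - 1 else 1)"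

text \<open>
  These axioms are the usual definition in characteristic zero; in characteristic 2 or 3 further
  conditions would be needed.
\<close>

locale lie_superalgebra = vector_space "scl L"
  for L :: "('f::field, 'v::ab_group_add) superalgebra" +
  assumes subspace_part: "subspace (part L a)"
    and part_direct: "part L 0 \<inter> part L 1 = {0}"
    and brk_add_left:
      "\<lbrakk>x \<in> carr L; y \<in> carr L; w \<in> carr L\<rbrakk> \<Longrightarrow> brk L (x + y) w = brk L x w + brk L y w"
    and brk_add_right:
      "\<lbrakk>x \<in> carr L; y \<in> carr L; w \<in> carr L\<rbrakk> \<Longrightarrow> brk L w (x + y) = brk L w x + brk L w y"
    and brk_scl_left:
      "\<lbrakk>x \<in> carr L; y \<in> carr L\<rbrakk> \<Longrightarrow> brk L (scl L c x) y = scl L c (brk L x y)"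
    and brk_scl_right:
      "\<lbrakk>x \<in> carr L; y \<in> carr L\<rbrakk> \<Longrightarrow> brk L x (scl L c y) = scl L c (brk L x y)"
    and brk_graded:
      "\<lbrakk>x \<in> part L a; y \<in> part L b\<rbrakk> \<Longrightarrow> brk L x y \<in> part L (a + b)"
    and brk_skew:
      "\<lbrakk>x \<in> part L a; y \<in> part L b\<rbrakk> \<Longrightarrow> brk L x y = - scl L (koszul_sign a b) (brk L y x)"
    and brk_jacobi:
      "\<lbrakk>x \<in> part L a; y \<in> part L b; w \<in> part L d\<rbrakk> \<Longrightarrow>
        brk L x (brk L y w) =
          brk L (brk L x y) w + scl L (koszul_sign a b) (brk L y (brk L x w))"

definition finite_dim :: "('f::field, 'v::ab_group_add) superalgebra \<Rightarrow> bool" where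
  "finite_dim L \<longleftrightarrow> (\<exists>B. finite B \<and> module.span (scl L) B = carr L)"

definition superdim :: "('f::field, 'v::ab_group_add) superalgebra \<Rightarrow> nat \<times> nat" where
  "superdim L = (vector_space.dim (scl L) (part L 0), vector_space.dim (scl L) (part L 1))"

definition derived :: "('f::field, 'v::ab_group_add) superalgebra \<Rightarrow> 'v set" where
  "derived L = module.span (scl L) {brk L x y | x y. x \<in> carr L \<and> y \<in> carr L}"

definition center :: "('f, 'v::ab_group_add) superalgebra \<Rightarrow> 'v set" where
  "center L = {z \<in> carr L. \<forall>x \<in> carr L. brk L z x = 0}"

definition special_heisenberg :: "('f::field, 'v::ab_group_add) superalgebra \<Rightarrow> bool" where
  "special_heisenberg L \<longleftrightarrow> derived L = center L \<and> vector_space.dim (scl L) (derived L) = 1"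

definition has_even_center :: "('f, 'v::ab_group_add) superalgebra \<Rightarrow> bool" where
  "has_even_center L \<longleftrightarrow> center L \<subseteq> part L 0"

definition superalgebra_iso ::
  "('f, 'v::ab_group_add) superalgebra \<Rightarrow> ('f, 'w::ab_group_add) superalgebra \<Rightarrow> ('v \<Rightarrow> 'w) \<Rightarrow> bool"
where
  "superalgebra_iso L M \<phi> \<longleftrightarrow>
     bij_betw \<phi> (carr L) (carr M) \<and>
     (\<forall>x \<in> carr L. \<forall>y \<in> carr L. \<phi> (x + y) = \<phi> x + \<phi> y) \<and>
     (\<forall>c. \<forall>x \<in> carr L. \<phi> (scl L c x) = scl M c (\<phi> x)) \<and>
     (\<forall>a. \<phi> ` part L a \<subseteq> part M a) \<and>
     (\<forall>x \<in> carr L. \<forall>y \<in> carr L. \<phi> (brk L x y) = brk M (\<phi> x) (\<phi> y))"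

definition superalgebra_isomorphic ::
  "('f, 'v::ab_group_add) superalgebra \<Rightarrow> ('f, 'w::ab_group_add) superalgebra \<Rightarrow> bool"
  (infix "\<cong>\<^sub>s" 50) where
  "L \<cong>\<^sub>s M \<longleftrightarrow> (\<exists>\<phi>. superalgebra_iso L M \<phi>)"

text \<open>
  \<open>H(m,n)\<close> is realised as the space of coordinate functions on its distinguished basis, that is,
  functions on \<^term>\<open>heis_basis m n\<close> extended by zero; \<open>heis_unit k\<close> is the basis vector \<open>k\<close>.
\<close>

datatype heis_gen = HX nat | HZ | HY nat

definition heis_even :: "nat \<Rightarrow> heis_gen set" where
  "heis_even m = insert HZ (HX ` {1..2 * m})"

definition heis_odd :: "nat \<Rightarrow> heis_gen set" where
  "heis_odd n = HY ` {1..n}"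

definition heis_basis :: "nat \<Rightarrow> nat \<Rightarrow> heis_gen set" where
  "heis_basis m n = heis_even m \<union> heis_odd n"

definition heis_unit :: "heis_gen \<Rightarrow> heis_gen \<Rightarrow> 'f::field" where
  "heis_unit k = (\<lambda>l. if l = k then 1 else 0)"

definition fun_scale :: "'f::field \<Rightarrow> ('k \<Rightarrow> 'f) \<Rightarrow> 'k \<Rightarrow> 'f" where
  "fun_scale c f = (\<lambda>k. c * f k)"

text \<open>
  Brackets of basis vectors: the listed ones, \<open>[x\<^sub>i, x\<^sub>m\<^sub>+\<^sub>i] = z = [y\<^sub>j, y\<^sub>j]\<close>, and
  those forced by graded skew-symmetry, \<open>[x\<^sub>m\<^sub>+\<^sub>i, x\<^sub>i] = - z\<close>.
\<close>

definition heis_table :: "nat \<Rightarrow> nat \<Rightarrow> heis_gen \<Rightarrow> heis_gen \<Rightarrow> heis_gen \<Rightarrow> 'f::field" where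
  "heis_table m n a b =
     (if \<exists>i \<in> {1..m}. a = HX i \<and> b = HX (m + i) then heis_unit HZ
      else if \<exists>i \<in> {1..m}. a = HX (m + i) \<and> b = HX i then - heis_unit HZ
      else if \<exists>j \<in> {1..n}. a = HY j \<and> b = HY j then heis_unit HZ
      else 0)"

definition heis_brk ::
  "nat \<Rightarrow> nat \<Rightarrow> (heis_gen \<Rightarrow> 'f::field) \<Rightarrow> (heis_gen \<Rightarrow> 'f) \<Rightarrow> heis_gen \<Rightarrow> 'f" where
  "heis_brk m n f g =
     (\<Sum>a \<in> heis_basis m n. \<Sum>b \<in> heis_basis m n. fun_scale (f a * g b) (heis_table m n a b))"

definition heisenberg :: "nat \<Rightarrow> nat \<Rightarrow> ('f::field, heis_gen \<Rightarrow> 'f) superalgebra" where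
  "heisenberg m n =
     \<lparr> scl = fun_scale,
       part = (\<lambda>a. {f. \<forall>k. k \<notin> (if a = 0 then heis_even m else heis_odd n) \<longrightarrow> f k = 0}),
       brk = heis_brk m n \<rparr>"

lemma finite_heis_basis [simp]: "finite (heis_basis m n)"
  by (simp add: heis_basis_def heis_even_def heis_odd_def)

lemma heis_table_skew:
  assumes "a \<in> (if p = 0 then heis_even m else heis_odd n)"
    and "b \<in> (if q = 0 then heis_even m else heis_odd n)"
  shows "heis_table m n a b = - fun_scale (koszul_sign p q) (heis_table m n b a)"
  using assms
  by (cases p; cases q)
    (auto simp: heis_table_def koszul_sign_def fun_scale_def heis_even_def heis_odd_def fun_eq_iff)

lemma heis_brk_apply:
  "heis_brk m n f g k =
     (\<Sum>a \<in> heis_basis m n. \<Sum>b \<in> heis_basis m n. f a * g b * heis_table m n a b k)"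
proof -
  have ap: "sum h A k = (\<Sum>a\<in>A. h a k)" if "finite A"
    for h :: "heis_gen \<Rightarrow> heis_gen \<Rightarrow> 'a" and A
    using that by (induction A rule: finite_induct) auto
  show ?thesis by (simp add: heis_brk_def ap fun_scale_def)
qed

lemma heis_brk_unit:
  assumes "a \<in> heis_basis m n" "b \<in> heis_basis m n"
  shows "heis_brk m n (heis_unit a) (heis_unit b) = heis_table m n a b"
proof
  fix k
  have "heis_brk m n (heis_unit a) (heis_unit b) k =
      (\<Sum>a'\<in>heis_basis m n. \<Sum>b'\<in>heis_basis m n.
        if b' = b then (if a' = a then heis_table m n a b k else 0) else 0)"
    unfolding heis_brk_apply by (intro sum.cong refl) (auto simp: heis_unit_def)
  thus "heis_brk m n (heis_unit a) (heis_unit b) k = heis_table m n a b k"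
    using assms by simp
qed

lemma heis_brk_at_nonZ: "k \<noteq> HZ \<Longrightarrow> heis_brk m n f g k = 0"
  by (auto simp: heis_brk_apply heis_table_def heis_unit_def intro!: sum.neutral)

lemma heis_brk_central:
  assumes "\<And>k. k \<noteq> HZ \<Longrightarrow> f k = 0"
  shows "heis_brk m n f g = 0" "heis_brk m n g f = 0"
proof -
  have "f a * g b * heis_table m n a b k = 0" "g b * f a * heis_table m n b a k = 0" for a b k
    using assms by (cases "a = HZ"; auto simp: heis_table_def)+
  thus "heis_brk m n f g = 0" "heis_brk m n g f = 0"
    by (simp_all add: fun_eq_iff heis_brk_apply del: mult_eq_0_iff)
qed

lemma lie_superalgebra_heisenberg:
  "lie_superalgebra (heisenberg m n :: ('f::field, heis_gen \<Rightarrow> 'f) superalgebra)"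
proof -
  let ?H = "heisenberg m n :: ('f, heis_gen \<Rightarrow> 'f) superalgebra"
  have vs: "vector_space (fun_scale :: 'f \<Rightarrow> (heis_gen \<Rightarrow> 'f) \<Rightarrow> _)"
    by unfold_locales (auto simp: fun_scale_def fun_eq_iff algebra_simps)
  interpret vector_space "fun_scale :: 'f \<Rightarrow> (heis_gen \<Rightarrow> 'f) \<Rightarrow> _" by (rule vs)
  have skew: "heis_brk m n x y = - fun_scale (koszul_sign p q) (heis_brk m n y x)"
    if "x \<in> part ?H p" "y \<in> part ?H q" for x y p q
  proof
    fix k
    have *: "x a * y b * heis_table m n a b k =
        - koszul_sign p q * (y b * x a * heis_table m n b a k)" for a b
    proof (cases "x a = 0 \<or> y b = 0")
      case False
      with that have "a \<in> (if p = 0 then heis_even m else heis_odd n)"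
        "b \<in> (if q = 0 then heis_even m else heis_odd n)"
        by (auto simp: heisenberg_def)
      from heis_table_skew[OF this, where 'a = 'f] show ?thesis
        by (simp add: fun_scale_def fun_eq_iff)
    qed auto
    show "heis_brk m n x y k = (- fun_scale (koszul_sign p q) (heis_brk m n y x)) k"
      by (subst heis_brk_apply, subst *, subst sum.swap)
        (simp add: heis_brk_apply fun_scale_def sum_distrib_left sum_negf)
  qed
  have graded: "heis_brk m n x y \<in> part ?H (p + q)"
    if "x \<in> part ?H p" "y \<in> part ?H q" for x y p q
  proof (cases "p = q")
    case True
    hence "p + q = 0" by (cases p; cases q) auto
    thus ?thesis by (auto simp: heisenberg_def heis_even_def heis_brk_at_nonZ)
  next
    case False
    have "x a * y b * heis_table m n a b k = 0" for a b k
    proof (rule ccontr)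
      assume "\<not> ?thesis"
      with that have "a \<in> (if p = 0 then heis_even m else heis_odd n)"
        "b \<in> (if q = 0 then heis_even m else heis_odd n)" "heis_table m n a b k \<noteq> (0::'f)"
        by (auto simp: heisenberg_def)
      with False show False
        by (cases p; cases q) (auto simp: heis_table_def heis_even_def heis_odd_def)
    qed
    hence "heis_brk m n x y = 0"
      by (simp add: fun_eq_iff heis_brk_apply del: mult_eq_0_iff)
    thus ?thesis by (simp add: heisenberg_def)
  qed
  have "lie_superalgebra_axioms ?H"
  proof
    show "module.subspace (scl ?H) (part ?H a)" for a
      by (auto simp: heisenberg_def subspace_def fun_scale_def)
    show "part ?H 0 \<inter> part ?H 1 = {0}"
    proof -
      have "x = 0" if "x \<in> part ?H 0" "x \<in> part ?H 1" for x
      proof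
        fix k
        show "x k = 0 k"
          using that by (cases k) (auto simp: heisenberg_def heis_even_def heis_odd_def)
      qed
      moreover have "0 \<in> part ?H a" for a
        by (simp add: heisenberg_def)
      ultimately show ?thesis by blast
    qed
    show "brk ?H (x + y) w = brk ?H x w + brk ?H y w" for x y w
      by (simp add: heisenberg_def fun_eq_iff heis_brk_apply algebra_simps sum.distrib)
    show "brk ?H w (x + y) = brk ?H w x + brk ?H w y" for x y w
      by (simp add: heisenberg_def fun_eq_iff heis_brk_apply algebra_simps sum.distrib)
    show "brk ?H (scl ?H c x) y = scl ?H c (brk ?H x y)" for c x y
      by (simp add: heisenberg_def fun_eq_iff heis_brk_apply fun_scale_def sum_distrib_left mult_ac)
    show "brk ?H x (scl ?H c y) = scl ?H c (brk ?H x y)" for c x y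
      by (simp add: heisenberg_def fun_eq_iff heis_brk_apply fun_scale_def sum_distrib_left mult_ac)
    show "brk ?H x y \<in> part ?H (a + b)" if "x \<in> part ?H a" "y \<in> part ?H b" for x y a b
      using graded[OF that] by (simp add: heisenberg_def)
    show "brk ?H x y = - scl ?H (koszul_sign a b) (brk ?H y x)"
      if "x \<in> part ?H a" "y \<in> part ?H b" for x y a b
      using skew[OF that] by (simp add: heisenberg_def)
    show "brk ?H x (brk ?H y w) =
        brk ?H (brk ?H x y) w + scl ?H (koszul_sign a b) (brk ?H y (brk ?H x w))" for x y w a b
      by (simp add: heisenberg_def heis_brk_central heis_brk_at_nonZ scale_zero_right)
  qed
  with vs show ?thesis
    by (simp add: lie_superalgebra_def heisenberg_def)
qed

end

theory Submission
  imports Defs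
begin

text \<open>
  Since \<open>L' = Z(L)\<close> is spanned by one even vector \<open>z\<close>, the bracket is \<open>[x, y] = \<beta>(x, y) z\<close> for a scalar form
  \<open>\<beta>\<close> that pairs the two parts trivially, is alternating on the even part and symmetric on the odd
  part. The radical of \<open>\<beta>\<close> on either part is central, hence \<open>\<langle>z\<rangle>\<close> on the even part and zero on the odd
  part. A symplectic basis modulo \<open>z\<close> and an orthonormal basis (which exists because scalars have
  square roots) then satisfy the relations of \<open>H(m,n)\<close>.
\<close>

section \<open>Bilinear forms on a subspace\<close>

text \<open>A repetition \<open>e i = e j\<close> with \<open>i \<noteq> j\<close> is itself a
  vanishing combination, with coefficients 1 and -1. Thus the coefficient condition also gives
  injectivity, and the image has as many vectors as there are indices.\<close>

lemma (in vector_space) independent_image_if_coeffs_zero: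
  assumes "finite K"
    and zero: "\<And>f k. (\<Sum>k\<in>K. scale (f k) (e k)) = 0 \<Longrightarrow> k \<in> K \<Longrightarrow> f k = 0"
  shows "inj_on e K" "independent (e ` K)"
proof -
  show inj: "inj_on e K"
  proof
    fix i j assume ij: "i \<in> K" "j \<in> K" "e i = e j"
    show "i = j"
    proof (rule ccontr)
      assume "i \<noteq> j"
      let ?f = "(\<lambda>_. 0)(i := 1, j := - 1)"
      have "(\<Sum>k\<in>K. scale (?f k) (e k)) = (\<Sum>k\<in>{i, j}. scale (?f k) (e k))"
        using ij \<open>finite K\<close> by (intro sum.mono_neutral_right) auto
      also have "\<dots> = 0"
        using ij \<open>i \<noteq> j\<close> by simp
      finally show False
        using zero[of ?f j] ij by simp
    qed
  qed
  show "independent (e ` K)"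
  proof (rule independent_if_scalars_zero)
    fix f x assume "(\<Sum>x\<in>e ` K. scale (f x) x) = 0" "x \<in> e ` K"
    then show "f x = 0"
      using zero[of "f \<circ> e"] by (auto simp: sum.reindex[OF inj])
  qed (use \<open>finite K\<close> in simp)
qed

text \<open>The axioms are relative to \<open>W\<close> because a bracket is controlled only on the
  carrier. One and the same \<open>\<beta>\<close> can then be treated as a form on the carrier and
  on each of the two parts.\<close>

locale form_on = vector_space scale
  for scale :: "'f::field \<Rightarrow> 'v::ab_group_add \<Rightarrow> 'v" +
  fixes W :: "'v set" and \<beta> :: "'v \<Rightarrow> 'v \<Rightarrow> 'f"
  assumes subspace_W: "subspace W"
    and form_add_left: "\<lbrakk>x \<in> W; y \<in> W; w \<in> W\<rbrakk> \<Longrightarrow> \<beta> (x + y) w = \<beta> x w + \<beta> y w"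
    and form_add_right: "\<lbrakk>x \<in> W; y \<in> W; w \<in> W\<rbrakk> \<Longrightarrow> \<beta> w (x + y) = \<beta> w x + \<beta> w y"
    and form_scale_left: "\<lbrakk>x \<in> W; y \<in> W\<rbrakk> \<Longrightarrow> \<beta> (scale c x) y = c * \<beta> x y"
    and form_scale_right: "\<lbrakk>x \<in> W; y \<in> W\<rbrakk> \<Longrightarrow> \<beta> x (scale c y) = c * \<beta> x y"
begin

lemma form_zero_left: "w \<in> W \<Longrightarrow> \<beta> 0 w = 0"
  using form_scale_left[of w w 0] by simp

lemma form_zero_right: "w \<in> W \<Longrightarrow> \<beta> w 0 = 0"
  using form_scale_right[of w w 0] by simp

lemma form_minus_left: "\<lbrakk>x \<in> W; y \<in> W\<rbrakk> \<Longrightarrow> \<beta> (- x) y = - \<beta> x y"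
  using form_scale_left[of x y "- 1"] by simp

lemma form_diff_left: "\<lbrakk>x \<in> W; y \<in> W; w \<in> W\<rbrakk> \<Longrightarrow> \<beta> (x - y) w = \<beta> x w - \<beta> y w"
  using form_add_left[of x "- y" w] by (simp add: form_minus_left subspace_neg[OF subspace_W])

lemma combination_in_W: "(\<And>k. k \<in> K \<Longrightarrow> e k \<in> W) \<Longrightarrow> (\<Sum>k\<in>K. scale (f k) (e k)) \<in> W"
  by (intro subspace_sum subspace_scale subspace_W)

lemma form_combination_left:
  assumes "\<And>k. k \<in> K \<Longrightarrow> e k \<in> W" "w \<in> W"
  shows "\<beta> (\<Sum>k\<in>K. scale (f k) (e k)) w = (\<Sum>k\<in>K. f k * \<beta> (e k) w)"
  using assms(1)
proof (induction K rule: infinite_finite_induct)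
  case (insert k K)
  then show ?case
    using assms(2)
    by (simp add: form_add_left form_scale_left combination_in_W subspace_scale[OF subspace_W])
qed (use assms(2) in \<open>simp_all add: form_zero_left\<close>)

lemma form_combination_right:
  assumes "\<And>k. k \<in> K \<Longrightarrow> e k \<in> W" "w \<in> W"
  shows "\<beta> w (\<Sum>k\<in>K. scale (f k) (e k)) = (\<Sum>k\<in>K. f k * \<beta> w (e k))"
  using assms(1)
proof (induction K rule: infinite_finite_induct)
  case (insert k K)
  then show ?case
    using assms(2)
    by (simp add: form_add_right form_scale_right combination_in_W subspace_scale[OF subspace_W])
qed (use assms(2) in \<open>simp_all add: form_zero_right\<close>)

text \<open>The vectors of \<open>W\<close> orthogonal to \<open>r\<close> form a subspace.\<close>

lemma form_span_zero:
  assumes "r \<in> W" "S \<subseteq> W" "\<And>s. s \<in> S \<Longrightarrow> \<beta> r s = 0" "w \<in> span S"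
  shows "\<beta> r w = 0"
proof -
  have "subspace {w \<in> W. \<beta> r w = 0}"
    using assms(1) subspace_W
    by (auto simp: subspace_def form_zero_right form_add_right form_scale_right)
  then have "span S \<subseteq> {w \<in> W. \<beta> r w = 0}"
    using assms by (intro span_minimal) auto
  then show ?thesis
    using assms(4) by blast
qed

text \<open>Pairing a vanishing combination of the \<open>u i\<close> with \<open>u' k\<close>
  isolates the coefficient of \<open>u k\<close>, so a family with a dual family is independent. The
  resulting bound ensures that symplectic and orthonormal families of maximal size exist.\<close>

lemma dual_family_card_le:
  assumes "finite B" "W \<subseteq> span B" "finite K" "u ` K \<subseteq> W" "u' ` K \<subseteq> W"
    and dual: "\<And>i j. i \<in> K \<Longrightarrow> j \<in> K \<Longrightarrow> \<beta> (u i) (u' j) = (if i = j then 1 else 0)"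
  shows "card K \<le> card B"
proof -
  have "f k = 0" if "(\<Sum>k\<in>K. scale (f k) (u k)) = 0" "k \<in> K" for f k
  proof -
    have "0 = \<beta> (\<Sum>k\<in>K. scale (f k) (u k)) (u' k)"
      using that assms(5) by (auto simp: form_zero_left)
    also have "\<dots> = (\<Sum>i\<in>K. f i * \<beta> (u i) (u' k))"
      using that assms by (intro form_combination_left) auto
    also have "\<dots> = (\<Sum>i\<in>K. if i = k then f i else 0)"
      using that by (intro sum.cong) (auto simp: dual)
    finally show ?thesis
      using that assms(3) by simp
  qed
  then have "inj_on u K" "independent (u ` K)"
    using independent_image_if_coeffs_zero[of K u] assms(3) by blast+
  moreover have "u ` K \<subseteq> span B"
    using assms by blast
  ultimately show ?thesis
    using independent_span_bound[OF assms(1)] by (metis card_image)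
qed

text \<open>These are \<open>m\<close> hyperbolic pairs. All four kinds of pairing are recorded
  because the locale does not make the form alternating. Indices start at 1, as in
  \<open>heis_table\<close>; values at other indices are free, so a family grows by a function
  update.\<close>

definition symplectic_family :: "nat \<Rightarrow> (nat \<Rightarrow> 'v) \<Rightarrow> (nat \<Rightarrow> 'v) \<Rightarrow> bool" where
  "symplectic_family m p q \<longleftrightarrow> p ` {1..m} \<subseteq> W \<and> q ` {1..m} \<subseteq> W \<and>
     (\<forall>i\<in>{1..m}. \<forall>j\<in>{1..m}. \<beta> (p i) (p j) = 0 \<and> \<beta> (q i) (q j) = 0 \<and>
        \<beta> (p i) (q j) = (if i = j then 1 else 0) \<and> \<beta> (q i) (p j) = (if i = j then - 1 else 0))"

lemma symplectic_family_spans_mod_radical: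
  assumes "finite B" "W \<subseteq> span B" and alt: "\<And>x. x \<in> W \<Longrightarrow> \<beta> x x = 0"
  obtains m p q where "symplectic_family m p q"
    and "\<And>v. v \<in> W \<Longrightarrow> \<exists>r\<in>W. (\<forall>w\<in>W. \<beta> r w = 0) \<and> v - r \<in> span (p ` {1..m} \<union> q ` {1..m})"
proof -
  \<comment> \<open>A family of maximal size does the job: two vectors of its orthogonal complement that pair
    nontrivially would extend it.\<close>
  have skew: "\<beta> y x = - \<beta> x y" if "x \<in> W" "y \<in> W" for x y
  proof -
    have "0 = \<beta> (x + y) (x + y)"
      using that subspace_W by (simp add: alt subspace_add)
    also have "\<dots> = \<beta> x y + \<beta> y x"
      using that subspace_W by (simp add: form_add_left form_add_right alt[of x] alt[of y] subspace_add)
    finally show ?thesis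
      using minus_unique[of "\<beta> x y" "\<beta> y x"] by simp
  qed
  have "\<exists>m. (\<exists>p q. symplectic_family m p q) \<and> (\<forall>k. (\<exists>p q. symplectic_family k p q) \<longrightarrow> k \<le> m)"
  \<comment> \<open>The empty family starts the search. The rule wants a strict bound, hence the
    successor.\<close>
  proof (rule ex_has_greatest_nat[where f = "\<lambda>k. k" and k = 0 and b = "Suc (card B)"])
    show "\<exists>p q. symplectic_family 0 p q"
      by (simp add: symplectic_family_def)
    show "\<forall>k. (\<exists>p q. symplectic_family k p q) \<longrightarrow> k < Suc (card B)"
    proof safe
      fix k p q assume "symplectic_family k p q"
      then show "k < Suc (card B)"
        using dual_family_card_le[OF assms(1,2), of "{1..k}" p q]
        by (simp add: symplectic_family_def less_Suc_eq_le)
    qed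
  qed
  then obtain m p q where fam: "symplectic_family m p q"
    and max: "\<And>k p q. symplectic_family k p q \<Longrightarrow> k \<le> m"
    by blast
  let ?K = "{1..m}"
  have pW: "p i \<in> W" and qW: "q i \<in> W" if "i \<in> ?K" for i
    using fam that by (auto simp: symplectic_family_def)
  \<comment> \<open>Orthogonality is imposed on one side; \<open>skew\<close> supplies the other.
    This complement will turn out to be the radical of the form.\<close>
  define perp where "perp = {w \<in> W. \<forall>i\<in>?K. \<beta> w (p i) = 0 \<and> \<beta> w (q i) = 0}"
  have perpD: "w \<in> W" "i \<in> ?K \<Longrightarrow> \<beta> w (p i) = 0" "i \<in> ?K \<Longrightarrow> \<beta> w (q i) = 0"
    "i \<in> ?K \<Longrightarrow> \<beta> (p i) w = 0" "i \<in> ?K \<Longrightarrow> \<beta> (q i) w = 0" if "w \<in> perp" for w i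
    using that skew[OF _ pW, of w i] skew[OF _ qW, of w i]
    by (simp_all add: perp_def)
  have perp0: "\<beta> v w = 0" if "v \<in> perp" "w \<in> perp" for v w
  proof (rule ccontr)
    assume nz: "\<beta> v w \<noteq> 0"
    \<comment> \<open>Rescaling makes the pairing with \<open>v\<close> equal to 1, so
      \<open>v\<close> and \<open>?w\<close> form the hyperbolic pair number
      \<open>Suc m\<close>.\<close>
    let ?w = "scale (inverse (\<beta> v w)) w"
    have w: "?w \<in> perp"
      using that subspace_W pW qW
      by (auto simp: perp_def form_scale_left subspace_scale)
    have *: "i \<in> {1..Suc m} \<longleftrightarrow> i = Suc m \<or> i \<in> ?K" for i
      by auto
    have "\<beta> v ?w = 1" "\<beta> ?w v = - 1"
      using perpD(1)[OF that(1)] perpD(1)[OF that(2)] nz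
      by (simp_all add: form_scale_right form_scale_left skew[of v w])
    then have "symplectic_family (Suc m) (p(Suc m := v)) (q(Suc m := ?w))"
      using fam perpD[OF that(1)] perpD[OF w] alt
      unfolding symplectic_family_def image_subset_iff Ball_def * by auto
    from max[OF this] show False by simp
  qed
  have decomp: "\<exists>r\<in>perp. v - r \<in> span (p ` ?K \<union> q ` ?K)" if v: "v \<in> W" for v
  proof
    \<comment> \<open>The projection of \<open>v\<close> to the span of the family is
      \<open>P - Q\<close>. Each coefficient is the pairing with the opposite member of the pair,
      and \<open>Q\<close> enters with a minus sign because
      \<open>\<beta> (q i) (p i) = - 1\<close>.\<close>
    define P where "P = (\<Sum>j\<in>?K. scale (\<beta> v (q j)) (p j))"
    define Q where "Q = (\<Sum>j\<in>?K. scale (\<beta> v (p j)) (q j))"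
    have PQ: "P \<in> W" "Q \<in> W"
      by (auto simp: P_def Q_def intro!: combination_in_W pW qW)
    have "v - (v - P + Q) = P - Q"
      by simp
    also have "P \<in> span (p ` ?K \<union> q ` ?K)" "Q \<in> span (p ` ?K \<union> q ` ?K)"
      unfolding P_def Q_def by (auto intro!: span_sum span_scale intro: span_base)
    then have "P - Q \<in> span (p ` ?K \<union> q ` ?K)"
      by (rule span_diff)
    finally show "v - (v - P + Q) \<in> span (p ` ?K \<union> q ` ?K)" .
    have "\<beta> P (p i) = 0" "\<beta> Q (q i) = 0" "\<beta> P (q i) = \<beta> v (q i)" "\<beta> Q (p i) = - \<beta> v (p i)"
      if i: "i \<in> ?K" for i
    proof -
      have eq: "\<beta> P w = (\<Sum>j\<in>?K. \<beta> v (q j) * \<beta> (p j) w)"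
        "\<beta> Q w = (\<Sum>j\<in>?K. \<beta> v (p j) * \<beta> (q j) w)" if "w \<in> W" for w
        unfolding P_def Q_def using that by (auto intro!: form_combination_left pW qW)
      show "\<beta> P (p i) = 0" "\<beta> Q (q i) = 0"
        using i fam by (auto simp: eq pW qW symplectic_family_def intro!: sum.neutral)
      have "\<beta> P (q i) = (\<Sum>j\<in>?K. if j = i then \<beta> v (q i) else 0)"
        "\<beta> Q (p i) = (\<Sum>j\<in>?K. if j = i then - \<beta> v (p i) else 0)"
        using i fam unfolding eq[OF pW[OF i]] eq[OF qW[OF i]]
        by (intro sum.cong refl; simp add: symplectic_family_def)+
      then show "\<beta> P (q i) = \<beta> v (q i)" "\<beta> Q (p i) = - \<beta> v (p i)"
        using i by simp_all
    qed
    moreover have "v - P + Q \<in> W"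
      using v PQ subspace_W by (intro subspace_add subspace_diff)
    moreover have "\<beta> (v - P + Q) w = \<beta> v w - \<beta> P w + \<beta> Q w" if "w \<in> W" for w
      using that v PQ subspace_W by (simp add: form_add_left form_diff_left subspace_diff)
    ultimately show "v - P + Q \<in> perp"
      by (auto simp: perp_def pW qW)
  qed
  \<comment> \<open>Split \<open>w\<close> into a vector in the span of the family, orthogonal to
    \<open>r\<close> by definition of \<open>perp\<close>, and a vector of \<open>perp\<close>,
    orthogonal to \<open>r\<close> by \<open>perp0\<close>.\<close>
  have rad: "\<beta> r w = 0" if r: "r \<in> perp" and w: "w \<in> W" for r w
  proof -
    obtain s where s: "s \<in> perp" "w - s \<in> span (p ` ?K \<union> q ` ?K)"
      using decomp[OF w] by blast
    have "\<beta> r (w - s) = 0"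
      by (rule form_span_zero[OF _ _ _ s(2)]) (use perpD[OF r] pW qW in auto)
    moreover have "w - s \<in> W"
      using w perpD(1)[OF s(1)] subspace_W by (intro subspace_diff)
    ultimately show ?thesis
      using form_add_right[of "w - s" s r] perp0[OF r s(1)] perpD(1)[OF r] perpD(1)[OF s(1)]
      by simp
  qed
  show thesis
    using that[OF fam] decomp rad perpD(1) by meson
qed

definition orthonormal_family :: "nat \<Rightarrow> (nat \<Rightarrow> 'v) \<Rightarrow> bool" where
  "orthonormal_family n y \<longleftrightarrow> y ` {1..n} \<subseteq> W \<and>
     (\<forall>i\<in>{1..n}. \<forall>j\<in>{1..n}. \<beta> (y i) (y j) = (if i = j then 1 else 0))"

text \<open>Take an orthonormal family of maximal size. A vector \<open>v\<close> of its orthogonal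
  complement with \<open>\<beta> v v \<noteq> 0\<close> could be divided by a square root of
  \<open>\<beta> v v\<close> and appended, so all vectors there are isotropic. Polarisation, which
  divides by 2, makes the form vanish on the complement; orthogonal projection then shows that the
  complement lies in the radical.\<close>

lemma orthonormal_family_spans_mod_radical:
  assumes "finite B" "W \<subseteq> span B" and sym: "\<And>x y. x \<in> W \<Longrightarrow> y \<in> W \<Longrightarrow> \<beta> x y = \<beta> y x"
    and sqrt: "\<And>a::'f. \<exists>c. c ^ 2 = a" and two: "(2::'f) \<noteq> 0"
  obtains n y where "orthonormal_family n y"
    and "\<And>v. v \<in> W \<Longrightarrow> \<exists>r\<in>W. (\<forall>w\<in>W. \<beta> r w = 0) \<and> v - r \<in> span (y ` {1..n})"
proof -
  have "\<exists>n. (\<exists>y. orthonormal_family n y) \<and> (\<forall>k. (\<exists>y. orthonormal_family k y) \<longrightarrow> k \<le> n)"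
  proof (rule ex_has_greatest_nat[where f = "\<lambda>k. k" and k = 0 and b = "Suc (card B)"])
    show "\<exists>y. orthonormal_family 0 y"
      by (simp add: orthonormal_family_def)
    show "\<forall>k. (\<exists>y. orthonormal_family k y) \<longrightarrow> k < Suc (card B)"
    proof safe
      fix k y assume "orthonormal_family k y"
      then show "k < Suc (card B)"
        using dual_family_card_le[OF assms(1,2), of "{1..k}" y y]
        by (simp add: orthonormal_family_def less_Suc_eq_le)
    qed
  qed
  then obtain n y where fam: "orthonormal_family n y"
    and max: "\<And>k y. orthonormal_family k y \<Longrightarrow> k \<le> n"
    by blast
  let ?K = "{1..n}"
  have yW: "y i \<in> W" if "i \<in> ?K" for i
    using fam that by (auto simp: orthonormal_family_def)
  define perp where "perp = {w \<in> W. \<forall>i\<in>?K. \<beta> w (y i) = 0}"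
  have perpD: "w \<in> W" "i \<in> ?K \<Longrightarrow> \<beta> w (y i) = 0" "i \<in> ?K \<Longrightarrow> \<beta> (y i) w = 0"
    if "w \<in> perp" for w i
    using that sym yW by (auto simp: perp_def)
  have isotropic: "\<beta> v v = 0" if v: "v \<in> perp" for v
  proof (rule ccontr)
    assume nz: "\<beta> v v \<noteq> 0"
    obtain c where c: "c ^ 2 = \<beta> v v"
      using sqrt by blast
    with nz have "c \<noteq> 0" by auto
    let ?w = "scale (inverse c) v"
    have w: "?w \<in> perp"
      using v subspace_W yW by (auto simp: perp_def form_scale_left subspace_scale)
    have *: "i \<in> {1..Suc n} \<longleftrightarrow> i = Suc n \<or> i \<in> ?K" for i
      by auto
    have "\<beta> ?w ?w = 1"
      using perpD(1)[OF v] perpD(1)[OF w] \<open>c \<noteq> 0\<close> c[symmetric]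
      by (simp add: form_scale_right form_scale_left power2_eq_square field_simps)
    then have "orthonormal_family (Suc n) (y(Suc n := ?w))"
      using fam perpD[OF w]
      unfolding orthonormal_family_def image_subset_iff Ball_def * by auto
    from max[OF this] show False by simp
  qed
  have perp0: "\<beta> v w = 0" if "v \<in> perp" "w \<in> perp" for v w
  proof -
    have W: "v \<in> W" "w \<in> W"
      using that by (auto dest: perpD(1))
    have "v + w \<in> perp"
      using that subspace_W yW by (auto simp: perp_def form_add_left subspace_add)
    then have "0 = \<beta> (v + w) (v + w)"
      by (simp add: isotropic)
    also have "\<dots> = 2 * \<beta> v w"
      using W subspace_W that
      by (simp add: form_add_left form_add_right subspace_add isotropic sym[of w v])
    finally show ?thesis
      using two by simp
  qed
  have decomp: "\<exists>r\<in>perp. v - r \<in> span (y ` ?K)" if v: "v \<in> W" for v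
  proof
    define P where "P = (\<Sum>j\<in>?K. scale (\<beta> v (y j)) (y j))"
    have P: "P \<in> W"
      by (auto simp: P_def intro!: combination_in_W yW)
    have "P \<in> span (y ` ?K)"
      unfolding P_def by (auto intro!: span_sum span_scale intro: span_base)
    then show "v - (v - P) \<in> span (y ` ?K)"
      by simp
    have "\<beta> P (y i) = \<beta> v (y i)" if i: "i \<in> ?K" for i
    proof -
      have "\<beta> P (y i) = (\<Sum>j\<in>?K. \<beta> v (y j) * \<beta> (y j) (y i))"
        unfolding P_def using i by (auto intro!: form_combination_left yW)
      also have "\<dots> = (\<Sum>j\<in>?K. if j = i then \<beta> v (y i) else 0)"
        using i fam by (intro sum.cong refl) (auto simp: orthonormal_family_def)
      finally show ?thesis
        using i by simp
    qed
    then show "v - P \<in> perp"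
      using v P subspace_W by (auto simp: perp_def yW form_diff_left subspace_diff)
  qed
  have rad: "\<beta> r w = 0" if r: "r \<in> perp" and w: "w \<in> W" for r w
  proof -
    obtain s where s: "s \<in> perp" "w - s \<in> span (y ` ?K)"
      using decomp[OF w] by blast
    have "\<beta> r (w - s) = 0"
      by (rule form_span_zero[OF _ _ _ s(2)]) (use perpD[OF r] yW in auto)
    moreover have "w - s \<in> W"
      using w perpD(1)[OF s(1)] subspace_W by (intro subspace_diff)
    ultimately show ?thesis
      using form_add_right[of "w - s" s r] perp0[OF r s(1)] perpD(1)[OF r] perpD(1)[OF s(1)]
      by simp
  qed
  show thesis
    using that[OF fam] decomp rad perpD(1) by meson
qed

end

section \<open>Isomorphisms of superalgebras\<close>

context lie_superalgebra
begin

lemma part_subset_carr: "part L a \<subseteq> carr L"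
proof
  fix x assume "x \<in> part L a"
  moreover have "0 \<in> part L b" for b
    using subspace_part subspace_0 by blast
  ultimately have "x + 0 \<in> carr L \<or> 0 + x \<in> carr L"
    unfolding carr_def by (cases a) blast+
  then show "x \<in> carr L" by simp
qed

lemma subspace_carr: "subspace (carr L)"
  using subspace_sums[OF subspace_part[of 0] subspace_part[of 1]] by (simp add: carr_def)

lemma brk_in_carr:
  assumes "x \<in> carr L" "y \<in> carr L"
  shows "brk L x y \<in> carr L"
proof -
  from assms obtain x0 x1 y0 y1 where
    *: "x = x0 + x1" "y = y0 + y1" "x0 \<in> part L 0" "x1 \<in> part L 1" "y0 \<in> part L 0" "y1 \<in> part L 1"
    by (auto simp: carr_def)
  then have c: "x0 \<in> carr L" "x1 \<in> carr L" "y0 \<in> carr L" "y1 \<in> carr L"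
    using part_subset_carr by blast+
  have "brk L x y = brk L x0 y0 + brk L x0 y1 + (brk L x1 y0 + brk L x1 y1)"
    using c assms * by (simp add: brk_add_left brk_add_right)
  also have "\<dots> \<in> carr L"
    using *(3-) brk_graded part_subset_carr by (intro subspace_add subspace_carr) blast+
  finally show ?thesis .
qed

end

text \<open>The point to check is that the inverse respects the grading, since
  \<open>superalgebra_iso\<close> only asks that parts be mapped into parts. The component of wrong
  parity of a preimage is sent into both parts of \<open>M\<close>, hence to 0, and vanishes by
  injectivity.\<close>

lemma superalgebra_isomorphic_sym:
  assumes L: "lie_superalgebra L" and M: "lie_superalgebra M" and "L \<cong>\<^sub>s M"
  shows "M \<cong>\<^sub>s L"
proof -
  interpret L: lie_superalgebra L by (rule L)
  interpret M: lie_superalgebra M by (rule M)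
  obtain \<phi> where "superalgebra_iso L M \<phi>"
    using \<open>L \<cong>\<^sub>s M\<close> by (auto simp: superalgebra_isomorphic_def)
  then have bij: "bij_betw \<phi> (carr L) (carr M)"
    and add: "\<And>x y. \<lbrakk>x \<in> carr L; y \<in> carr L\<rbrakk> \<Longrightarrow> \<phi> (x + y) = \<phi> x + \<phi> y"
    and scl: "\<And>c x. x \<in> carr L \<Longrightarrow> \<phi> (scl L c x) = scl M c (\<phi> x)"
    and part: "\<And>a. \<phi> ` part L a \<subseteq> part M a"
    and brk: "\<And>x y. \<lbrakk>x \<in> carr L; y \<in> carr L\<rbrakk> \<Longrightarrow> \<phi> (brk L x y) = brk M (\<phi> x) (\<phi> y)"
    by (simp_all add: superalgebra_iso_def)
  define \<psi> where "\<psi> = inv_into (carr L) \<phi>"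
  have inj: "inj_on \<phi> (carr L)" and surj: "\<phi> ` carr L = carr M"
    using bij by (auto simp: bij_betw_def)
  have \<psi>_in: "\<psi> y \<in> carr L" and \<phi>\<psi>: "\<phi> (\<psi> y) = y" if "y \<in> carr M" for y
    unfolding \<psi>_def using inv_into_into[of y \<phi> "carr L"] f_inv_into_f[of y \<phi> "carr L"] that surj
    by simp_all
  have \<psi>_eqI: "\<psi> y = x" if "x \<in> carr L" "\<phi> x = y" for x y
    unfolding \<psi>_def using inj that by (rule inv_into_f_eq)
  have \<phi>0: "\<phi> 0 = 0"
    using scl[of 0 0] L.subspace_0[OF L.subspace_carr] by simp
  have zeroI: "x = 0" if "x \<in> carr L" "\<phi> x = 0" for x
    using inj_onD[OF inj, of x 0] that \<phi>0 L.subspace_0[OF L.subspace_carr] by simp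
  have \<psi>_part: "\<psi> y \<in> part L a" if y: "y \<in> part M a" for y a
  proof -
    have yc: "y \<in> carr M"
      using y M.part_subset_carr by blast
    obtain x0 x1 where x: "\<psi> y = x0 + x1" "x0 \<in> part L 0" "x1 \<in> part L 1"
      using \<psi>_in[OF yc] by (auto simp: carr_def)
    have xc: "x0 \<in> carr L" "x1 \<in> carr L"
      using x L.part_subset_carr by blast+
    have eq: "y = \<phi> x0 + \<phi> x1"
      using \<phi>\<psi>[OF yc] add[OF xc] x(1) by simp
    have in_parts: "\<phi> x0 \<in> part M 0" "\<phi> x1 \<in> part M 1"
      using x part by blast+
    show ?thesis
    proof (cases a)
      case zero
      have "\<phi> x1 = y - \<phi> x0"
        using eq by simp
      also have "\<dots> \<in> part M 0"
        using y in_parts zero by (intro M.subspace_diff M.subspace_part) simp_all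
      finally have "\<phi> x1 = 0"
        using in_parts M.part_direct by blast
      with zeroI[OF xc(2)] x zero show ?thesis by simp
    next
      case one
      have "\<phi> x0 = y - \<phi> x1"
        using eq by simp
      also have "\<dots> \<in> part M 1"
        using y in_parts one by (intro M.subspace_diff M.subspace_part) simp_all
      finally have "\<phi> x0 = 0"
        using in_parts M.part_direct by blast
      with zeroI[OF xc(1)] x one show ?thesis by simp
    qed
  qed
  have "superalgebra_iso M L \<psi>"
    unfolding superalgebra_iso_def
  proof (intro conjI ballI allI)
    show "bij_betw \<psi> (carr M) (carr L)"
      unfolding \<psi>_def by (rule bij_betw_inv_into[OF bij])
    show "\<psi> ` part M a \<subseteq> part L a" for a
      using \<psi>_part by blast
    show "\<psi> (x + y) = \<psi> x + \<psi> y" if "x \<in> carr M" "y \<in> carr M" for x y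
      using that by (intro \<psi>_eqI) (auto simp: add \<psi>_in \<phi>\<psi> intro!: L.subspace_add L.subspace_carr)
    show "\<psi> (scl M c x) = scl L c (\<psi> x)" if "x \<in> carr M" for x c
      using that by (intro \<psi>_eqI) (auto simp: scl \<psi>_in \<phi>\<psi> intro!: L.subspace_scale L.subspace_carr)
    show "\<psi> (brk M x y) = brk L (\<psi> x) (\<psi> y)" if "x \<in> carr M" "y \<in> carr M" for x y
      using that by (intro \<psi>_eqI) (auto simp: brk \<psi>_in \<phi>\<psi> intro!: L.brk_in_carr)
  qed
  then show ?thesis
    by (auto simp: superalgebra_isomorphic_def)
qed

section \<open>Heisenberg superalgebras\<close>

text \<open>The \<open>HX\<close> generators are split at \<open>m\<close> because
  \<open>heis_table\<close> pairs index \<open>i\<close> with \<open>m + i\<close>.\<close>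

lemma heis_basis_cases:
  assumes "k \<in> heis_basis m n"
  obtains "k = HZ" | i where "i \<in> {1..m}" "k = HX i" | i where "i \<in> {1..m}" "k = HX (m + i)"
    | j where "j \<in> {1..n}" "k = HY j"
proof -
  from assms consider "k = HZ" | i where "i \<in> {1..2 * m}" "k = HX i" | j where "j \<in> {1..n}" "k = HY j"
    unfolding heis_basis_def heis_even_def heis_odd_def by blast
  then show thesis
  proof cases
    case (2 i)
    show thesis
    proof (cases "i \<le> m")
      case False
      then have "i - m \<in> {1..m}" "k = HX (m + (i - m))"
        using 2 by auto
      then show thesis by (rule that(3))
    qed (use 2 that(2) in auto)
  qed (use that(1,4) in auto)
qed

text \<open>Each noncentral generator has exactly one partner: \<open>HX i\<close> and
  \<open>HX (m + i)\<close> are partners of each other, \<open>HY j\<close> is its own. Pairing with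
  the partner therefore reads off a coordinate up to the sign \<open>s\<close>.\<close>

lemma heis_table_nondegenerate:
  assumes "k \<in> heis_basis m n" "k \<noteq> HZ"
  obtains b and s :: "'f::field" where "b \<in> heis_basis m n" "s \<noteq> 0"
    "\<And>a. a \<in> heis_basis m n \<Longrightarrow> heis_table m n a b HZ = (if a = k then s else 0)"
  using assms(1)
proof (cases rule: heis_basis_cases)
  case (2 i)
  then show thesis
    by (intro that[of "HX (m + i)" 1])
      (auto simp: heis_table_def heis_unit_def heis_basis_def heis_even_def heis_odd_def)
next
  case (3 i)
  then show thesis
    by (intro that[of "HX i" "- 1"])
      (auto simp: heis_table_def heis_unit_def heis_basis_def heis_even_def heis_odd_def)
next
  case (4 j)
  then show thesis
    by (intro that[of "HY j" 1])
      (auto simp: heis_table_def heis_unit_def heis_basis_def heis_even_def heis_odd_def)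
qed (use assms in simp)

lemma part_heisenberg:
  "f \<in> part (heisenberg m n) a \<longleftrightarrow> (\<forall>k. k \<notin> (if a = 0 then heis_even m else heis_odd n) \<longrightarrow> f k = 0)"
  by (simp add: heisenberg_def)

lemma carr_heisenberg:
  "carr (heisenberg m n) = {f. \<forall>k. k \<notin> heis_basis m n \<longrightarrow> f k = 0}"
proof (intro set_eqI iffI)
  fix f :: "heis_gen \<Rightarrow> 'f::field"
  assume "f \<in> carr (heisenberg m n)"
  then show "f \<in> {f. \<forall>k. k \<notin> heis_basis m n \<longrightarrow> f k = 0}"
    by (auto simp: carr_def part_heisenberg heis_basis_def)
next
  fix f :: "heis_gen \<Rightarrow> 'f::field"
  assume "f \<in> {f. \<forall>k. k \<notin> heis_basis m n \<longrightarrow> f k = 0}"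
  then have "f = (\<lambda>k. if k \<in> heis_even m then f k else 0) + (\<lambda>k. if k \<in> heis_odd n then f k else 0)"
    (is "_ = ?f0 + ?f1")
    by (auto simp: fun_eq_iff heis_basis_def heis_even_def heis_odd_def)
  moreover have "?f0 \<in> part (heisenberg m n) 0" "?f1 \<in> part (heisenberg m n) 1"
    by (simp_all add: part_heisenberg)
  ultimately show "f \<in> carr (heisenberg m n)"
    unfolding carr_def by blast
qed

lemma card_heis_even: "card (heis_even m) = 2 * m + 1"
proof -
  have "card (HX ` {1..2 * m}) = 2 * m"
    by (subst card_image) (auto intro: inj_onI)
  then show ?thesis
    unfolding heis_even_def by (subst card_insert_disjoint) auto
qed

lemma card_heis_odd: "card (heis_odd n) = n"
  unfolding heis_odd_def by (subst card_image) (auto intro: inj_onI)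

section \<open>Recognition of \<open>H(m,n)\<close> by a spanning family with its bracket
  relations\<close>

context lie_superalgebra
begin

text \<open>Independence of the spanning family \<open>e\<close> follows from the relations:
  partners detect every coefficient except that of \<open>HZ\<close>, and
  \<open>e HZ \<noteq> 0\<close> settles the last one. The dimensions are then cardinalities, and
  the coordinate map preserves brackets because both sides have only a central component.\<close>

lemma isomorphic_heisenberg_if_basis:
  assumes form: "form_on (scl L) (carr L) \<beta>"
    and brk: "\<And>x y. \<lbrakk>x \<in> carr L; y \<in> carr L\<rbrakk> \<Longrightarrow> brk L x y = scl L (\<beta> x y) (e HZ)"
    and nz: "e HZ \<noteq> 0"
    and even: "e ` heis_even m \<subseteq> part L 0" "part L 0 \<subseteq> span (e ` heis_even m)"
    and odd: "e ` heis_odd n \<subseteq> part L 1" "part L 1 \<subseteq> span (e ` heis_odd n)"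
    and table: "\<And>a b. \<lbrakk>a \<in> heis_basis m n; b \<in> heis_basis m n\<rbrakk> \<Longrightarrow>
      \<beta> (e a) (e b) = heis_table m n a b HZ"
  shows "superdim L = (2 * m + 1, n)"
    and "L \<cong>\<^sub>s (heisenberg m n :: ('f, heis_gen \<Rightarrow> 'f) superalgebra)"
proof -
  let ?H = "heisenberg m n :: ('f, heis_gen \<Rightarrow> 'f) superalgebra"
  let ?B = "heis_basis m n"
  interpret form_on "scl L" "carr L" \<beta>
    by (rule form)
  have e: "e k \<in> carr L" if "k \<in> ?B" for k
    using that even(1) odd(1) part_subset_carr unfolding heis_basis_def by blast
  have sub: "heis_even m \<subseteq> ?B" "heis_odd n \<subseteq> ?B"
    by (auto simp: heis_basis_def)
  have HZ: "HZ \<in> ?B"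
    by (simp add: heis_basis_def heis_even_def)
  \<comment> \<open>The map from coordinates to \<open>L\<close> is an explicit sum, so this
    direction is shown to be an isomorphism and inverted at the end.\<close>
  define \<psi> where "\<psi> f = (\<Sum>k\<in>?B. scl L (f k) (e k))" for f
  have \<psi>_carr: "\<psi> f \<in> carr L" for f
    unfolding \<psi>_def by (rule combination_in_W[OF e])
  have form_\<psi>: "\<beta> (\<psi> f) (\<psi> g) = heis_brk m n f g HZ" for f g
  proof -
    have "\<beta> (\<psi> f) (\<psi> g) = (\<Sum>a\<in>?B. f a * \<beta> (e a) (\<psi> g))"
      by (subst (1) \<psi>_def) (intro form_combination_left e \<psi>_carr)
    also have "\<dots> = (\<Sum>a\<in>?B. f a * (\<Sum>b\<in>?B. g b * \<beta> (e a) (e b)))"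
      unfolding \<psi>_def by (intro sum.cong refl arg_cong2[where f = "(*)"] form_combination_right e)
    finally show ?thesis
      by (simp add: heis_brk_apply sum_distrib_left table mult.assoc)
  qed
  have coeff_zero: "f k = 0" if "\<psi> f = 0" "k \<in> ?B" for f k
  proof -
    have nonZ: "f k = 0" if k: "k \<in> ?B" "k \<noteq> HZ" for k
    proof -
      obtain b and s :: 'f where b: "b \<in> ?B" "s \<noteq> 0"
        "\<And>a. a \<in> ?B \<Longrightarrow> heis_table m n a b HZ = (if a = k then s else 0)"
        using heis_table_nondegenerate[OF k] by metis
      have "0 = \<beta> (\<psi> f) (e b)"
        using \<open>\<psi> f = 0\<close> b e by (simp add: form_zero_left)
      also have "\<dots> = (\<Sum>a\<in>?B. f a * \<beta> (e a) (e b))"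
        unfolding \<psi>_def using b by (intro form_combination_left e)
      also have "\<dots> = (\<Sum>a\<in>?B. if a = k then f k * s else 0)"
        using b by (intro sum.cong) (auto simp: table)
      finally show ?thesis
        using k b by simp
    qed
    have "\<psi> f = (\<Sum>k\<in>{HZ}. scl L (f k) (e k))"
      unfolding \<psi>_def using nonZ HZ
      by (intro sum.mono_neutral_right) auto
    then have "f HZ = 0"
      using \<open>\<psi> f = 0\<close> nz by simp
    with nonZ \<open>k \<in> ?B\<close> show ?thesis
      by (cases "k = HZ") auto
  qed
  then have inj_e: "inj_on e ?B" and indep: "independent (e ` ?B)"
    using independent_image_if_coeffs_zero[of ?B e] by (auto simp: \<psi>_def)
  have "dim (part L 0) = 2 * m + 1"
    using even sub
    by (intro dim_unique[where B = "e ` heis_even m"])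
      (use independent_mono[OF indep image_mono[OF sub(1)]] in
        \<open>simp_all add: card_image[OF inj_on_subset[OF inj_e]] card_heis_even\<close>)
  moreover have "dim (part L 1) = n"
    using odd sub
    by (intro dim_unique[where B = "e ` heis_odd n"])
      (use independent_mono[OF indep image_mono[OF sub(2)]] in
        \<open>simp_all add: card_image[OF inj_on_subset[OF inj_e]] card_heis_odd\<close>)
  ultimately show "superdim L = (2 * m + 1, n)"
    by (simp add: superdim_def)
  have add: "\<psi> (f + g) = \<psi> f + \<psi> g" for f g
    by (simp add: \<psi>_def scale_left_distrib sum.distrib)
  have scl: "\<psi> (fun_scale c f) = scl L c (\<psi> f)" for c f
    by (simp add: \<psi>_def fun_scale_def scale_sum_right)
  have bij: "bij_betw \<psi> (carr ?H) (carr L)"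
  proof (intro bij_betw_imageI inj_onI set_eqI iffI)
    fix f g assume fg: "f \<in> carr ?H" "g \<in> carr ?H" "\<psi> f = \<psi> g"
    have "\<psi> (f - g) = 0"
      using add[of "f - g" g] fg(3) by simp
    then have "f k = g k" if "k \<in> ?B" for k
      using coeff_zero[of "f - g" k] that by simp
    moreover have "f k = g k" if "k \<notin> ?B" for k
      using fg(1,2) that by (simp add: carr_heisenberg)
    ultimately show "f = g"
      by blast
  next
    fix v assume "v \<in> carr L"
    then obtain x y where "v = x + y" "x \<in> part L 0" "y \<in> part L 1"
      by (auto simp: carr_def)
    then have "v \<in> span (e ` ?B)"
      using even(2) odd(2) span_mono[OF image_mono[OF sub(1), of e]] span_mono[OF image_mono[OF sub(2), of e]]
      by (auto intro!: span_add)
    then obtain u where "v = (\<Sum>x\<in>e ` ?B. scl L (u x) x)"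
      by (auto simp: span_finite)
    \<comment> \<open>Extension by zero puts the coordinate function into the carrier of
      \<open>?H\<close>.\<close>
    also have "\<dots> = \<psi> (\<lambda>k. if k \<in> ?B then u (e k) else 0)"
      by (auto simp: \<psi>_def sum.reindex[OF inj_e] intro!: sum.cong)
    finally show "v \<in> \<psi> ` carr ?H"
      by (auto simp: carr_heisenberg)
  qed (use \<psi>_carr in auto)
  have "superalgebra_iso ?H L \<psi>"
    unfolding superalgebra_iso_def
  proof (intro conjI allI ballI)
    show "bij_betw \<psi> (carr ?H) (carr L)" by (rule bij)
    show "\<psi> (f + g) = \<psi> f + \<psi> g" for f g by (rule add)
    show "\<psi> (scl ?H c f) = scl L c (\<psi> f)" for c f
      by (simp add: heisenberg_def scl)
    show "\<psi> ` part ?H a \<subseteq> part L a" for a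
    proof safe
      fix f assume f: "f \<in> part ?H a"
      show "\<psi> f \<in> part L a"
        unfolding \<psi>_def
      proof (intro subspace_sum subspace_part)
        fix k assume "k \<in> ?B"
        show "scl L (f k) (e k) \<in> part L a"
        proof (cases "f k = 0")
          case True
          then show ?thesis by (simp add: subspace_0 subspace_part)
        next
          case False
          with f have "k \<in> (if a = 0 then heis_even m else heis_odd n)"
            unfolding part_heisenberg by blast
          then have "e k \<in> part L a"
            using even(1) odd(1) by (cases a) auto
          then show ?thesis
            by (intro subspace_scale subspace_part)
        qed
      qed
    qed
    show "\<psi> (brk ?H f g) = brk L (\<psi> f) (\<psi> g)" for f g
    proof -
      have "\<psi> (heis_brk m n f g) = (\<Sum>k\<in>{HZ}. scl L (heis_brk m n f g k) (e k))"
        unfolding \<psi>_def using HZ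
        by (intro sum.mono_neutral_right) (auto simp: heis_brk_at_nonZ)
      then show ?thesis
        by (simp add: brk \<psi>_carr form_\<psi> heisenberg_def)
    qed
  qed
  then have "?H \<cong>\<^sub>s L"
    by (auto simp: superalgebra_isomorphic_def)
  then show "L \<cong>\<^sub>s ?H"
    by (rule superalgebra_isomorphic_sym[OF lie_superalgebra_heisenberg lie_superalgebra_axioms])
qed

end

section \<open>The form attached to the bracket and its adapted basis\<close>

theorem theorem4p2:
  fixes L :: "('f::{alg_closed_field, field_char_0}, 'v::ab_group_add) superalgebra"
  assumes "lie_superalgebra L"
    and "finite_dim L"
    and "special_heisenberg L"
    and "has_even_center L"
  shows "\<exists>m n. superdim L = (2 * m + 1, n) \<and>
           L \<cong>\<^sub>s (heisenberg m n :: ('f, heis_gen \<Rightarrow> 'f) superalgebra)"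
proof -
  interpret lie_superalgebra L by (rule assms(1))
  have part_carr: "x \<in> part L a \<Longrightarrow> x \<in> carr L" for x a
    using part_subset_carr by blast
  obtain B where B: "finite B" "span B = carr L"
    using assms(2) by (auto simp: finite_dim_def)
  have center_derived: "center L = derived L" and dim1: "dim (derived L) = 1"
    and center_even: "center L \<subseteq> part L 0"
    using assms(3,4) by (auto simp: special_heisenberg_def has_even_center_def)
  obtain S where S: "S \<subseteq> derived L" "independent S" "derived L \<subseteq> span S" "card S = 1"
    using basis_exists[of "derived L"] dim1 by metis
  then obtain z where "S = {z}"
    using card_1_singletonE by blast
  with S have z: "z \<in> center L" "z \<noteq> 0" and center_span: "center L \<subseteq> span {z}"
    by (auto simp: center_derived dependent_zero)
  have z0: "z \<in> part L 0" and zc: "z \<in> carr L"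
    using z center_even part_carr by blast+
  have brk_center: "brk L x y \<in> center L" if "x \<in> carr L" "y \<in> carr L" for x y
    using that by (auto simp: center_derived derived_def intro!: span_base)
  have "\<exists>c. brk L x y = scl L c z" if "x \<in> carr L" "y \<in> carr L" for x y
    using brk_center[OF that] center_span by (auto simp: span_singleton)
  then obtain \<beta> where brk: "\<And>x y. \<lbrakk>x \<in> carr L; y \<in> carr L\<rbrakk> \<Longrightarrow> brk L x y = scl L (\<beta> x y) z"
    by metis
  \<comment> \<open>Since \<open>z \<noteq> 0\<close>, the coefficient is unique on the carrier.
    Every property of the chosen \<open>\<beta>\<close> is obtained by comparing brackets through
    this rule.\<close>
  have \<beta>_eqI: "\<beta> x y = c" if "x \<in> carr L" "y \<in> carr L" "brk L x y = scl L c z" for x y c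
    using that z(2) brk[of x y] by (simp add: scale_cancel_right)
  have form: "form_on (scl L) (carr L) \<beta>"
  proof unfold_locales
    show "subspace (carr L)" by (rule subspace_carr)
  qed (intro \<beta>_eqI subspace_add subspace_scale subspace_carr;
      simp add: brk_add_left brk_add_right brk_scl_left brk_scl_right brk scale_left_distrib)+
  then interpret form_on "scl L" "carr L" \<beta> .
  have form_part: "form_on (scl L) (part L a) \<beta>" for a
    by unfold_locales
      (auto simp: subspace_part part_carr form_add_left form_add_right form_scale_left form_scale_right)
  interpret even: form_on "scl L" "part L 0" \<beta> by (rule form_part)
  interpret odd: form_on "scl L" "part L 1" \<beta> by (rule form_part)
  \<comment> \<open>The bracket is odd by the grading and even because it lies in the even
    center.\<close>
  have mixed: "\<beta> x y = 0" if "x \<in> part L a" "y \<in> part L b" "a \<noteq> b" for x y a b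
  proof (rule \<beta>_eqI)
    have "a + b = 1"
      using that(3) by (cases a; cases b) auto
    then have "brk L x y \<in> part L 1"
      using brk_graded[OF that(1,2)] by simp
    moreover have "brk L x y \<in> part L 0"
      using brk_center[of x y] that center_even part_carr by blast
    ultimately show "brk L x y = scl L 0 z"
      using part_direct by auto
  qed (use that part_carr in auto)
  have alt: "\<beta> x x = 0" if "x \<in> part L 0" for x
  proof -
    \<comment> \<open>The Koszul sign is 1 for even arguments; characteristic zero then gives the
      vanishing.\<close>
    have "\<beta> x x = - \<beta> x x"
      using brk_skew[OF that that] part_carr[OF that]
      by (intro \<beta>_eqI) (simp_all add: koszul_sign_def brk)
    then show ?thesis by simp
  qed
  \<comment> \<open>For odd arguments the Koszul sign cancels the sign of skew-symmetry.\<close>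
  have sym: "\<beta> x y = \<beta> y x" if "x \<in> part L 1" "y \<in> part L 1" for x y
    using brk_skew[OF that] that part_carr
    by (intro \<beta>_eqI) (auto simp: koszul_sign_def brk)
  \<comment> \<open>Orthogonality to the part of \<open>r\<close> suffices, because the other part
    is orthogonal to \<open>r\<close> by \<open>mixed\<close>.\<close>
  have radical: "r \<in> center L"
    if r: "r \<in> part L a" and rad: "\<forall>w\<in>part L a. \<beta> r w = 0" for r a
  proof -
    have in_part: "\<beta> r u = 0" if "u \<in> part L b" for u b
      using rad mixed[OF r that] that by (cases "a = b") auto
    have "\<beta> r w = 0" if w: "w \<in> carr L" for w
    proof -
      obtain x y where "w = x + y" "x \<in> part L 0" "y \<in> part L 1"
        using w by (auto simp: carr_def)
      moreover from this have "\<beta> r x = 0" "\<beta> r y = 0"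
        using in_part by blast+
      ultimately show ?thesis
        using r part_carr by (simp add: form_add_right)
    qed
    then show ?thesis
      using r part_carr by (auto simp: center_def brk)
  qed
  have part_span: "part L a \<subseteq> span B" for a
    using part_subset_carr by (simp add: B(2))
  have sqrt: "\<exists>c. c ^ 2 = a" for a :: 'f
    by (rule nth_root_exists) simp
  have two: "(2 :: 'f) \<noteq> 0"
    by simp
  obtain m p q where pq: "even.symplectic_family m p q"
    and even_span: "\<And>v. v \<in> part L 0 \<Longrightarrow>
      \<exists>r\<in>part L 0. (\<forall>w\<in>part L 0. \<beta> r w = 0) \<and> v - r \<in> span (p ` {1..m} \<union> q ` {1..m})"
    by (rule even.symplectic_family_spans_mod_radical[OF B(1) part_span], erule alt, blast intro: that)
  obtain n y where y: "odd.orthonormal_family n y"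
    and odd_span: "\<And>v. v \<in> part L 1 \<Longrightarrow>
      \<exists>r\<in>part L 1. (\<forall>w\<in>part L 1. \<beta> r w = 0) \<and> v - r \<in> span (y ` {1..n})"
    by (rule odd.orthonormal_family_spans_mod_radical[OF B(1) part_span sym sqrt two])
      (assumption | blast intro: that)+
  \<comment> \<open>The shift by \<open>m\<close> sends \<open>HX i\<close> and
    \<open>HX (m + i)\<close> to a hyperbolic pair.\<close>
  define e where "e k = (case k of HZ \<Rightarrow> z | HX i \<Rightarrow> if i \<le> m then p i else q (i - m) | HY j \<Rightarrow> y j)"
    for k
  have p: "p i \<in> part L 0" and q: "q i \<in> part L 0" if "i \<in> {1..m}" for i
    using pq that by (auto simp: even.symplectic_family_def)
  have y1: "y j \<in> part L 1" if "j \<in> {1..n}" for j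
    using y that by (auto simp: odd.orthonormal_family_def)
  have eZ: "e HZ = z" and eX: "i \<in> {1..m} \<Longrightarrow> e (HX i) = p i"
    and eX': "i \<in> {1..m} \<Longrightarrow> e (HX (m + i)) = q i" and eY: "e (HY j) = y j" for i j
    by (simp_all add: e_def)
  have e_even: "e ` heis_even m = insert z (p ` {1..m} \<union> q ` {1..m})"
  proof -
    have "{1..2 * m} = {1..m} \<union> (+) m ` {1..m}"
      by (auto simp: image_add_atLeastAtMost)
    then have "(\<lambda>i. e (HX i)) ` {1..2 * m} =
        (\<lambda>i. e (HX i)) ` {1..m} \<union> (\<lambda>i. e (HX (m + i))) ` {1..m}"
      by (simp only: image_Un image_image)
    also have "\<dots> = p ` {1..m} \<union> q ` {1..m}"
      by (intro arg_cong2[where f = "(\<union>)"] image_cong refl eX eX')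
    finally show ?thesis
      by (simp only: heis_even_def image_insert image_image eZ)
  qed
  have e_odd: "e ` heis_odd n = y ` {1..n}"
    by (simp add: heis_odd_def image_image eY)
  have z_left: "\<beta> z x = 0" if "x \<in> carr L" for x
    using z that zc by (intro \<beta>_eqI) (auto simp: center_def)
  \<comment> \<open>\<open>center\<close> speaks of brackets with \<open>z\<close> on the left;
    graded skew-symmetry turns them round for homogeneous \<open>x\<close>.\<close>
  have z_right: "\<beta> x z = 0" if x: "x \<in> part L a" for x a
    using mixed[OF x z0] brk_skew[OF x z0] z x zc part_carr
    by (intro \<beta>_eqI) (auto simp: center_def)
  have table: "\<beta> (e a) (e b) = heis_table m n a b HZ"
    if "a \<in> heis_basis m n" "b \<in> heis_basis m n" for a b
  proof -
    have even_part: "\<beta> (p i) (p j) = 0" "\<beta> (q i) (q j) = 0"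
      "\<beta> (p i) (q j) = (if i = j then 1 else 0)" "\<beta> (q i) (p j) = (if i = j then - 1 else 0)"
      if "i \<in> {1..m}" "j \<in> {1..m}" for i j
      using pq that by (auto simp: even.symplectic_family_def)
    have odd_part: "\<beta> (y i) (y j) = (if i = j then 1 else 0)" if "i \<in> {1..n}" "j \<in> {1..n}" for i j
      using y that by (auto simp: odd.orthonormal_family_def)
    have cross: "\<beta> (p i) (y j) = 0" "\<beta> (q i) (y j) = 0" "\<beta> (y j) (p i) = 0" "\<beta> (y j) (q i) = 0"
      if "i \<in> {1..m}" "j \<in> {1..n}" for i j
      using mixed[OF p y1] mixed[OF q y1] mixed[OF y1 p] mixed[OF y1 q] that by simp_all
    note central = z_left z_right[OF z0] z_right[OF p] z_right[OF q] z_right[OF y1]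
      zc part_carr[OF p] part_carr[OF q] part_carr[OF y1]
    show ?thesis
      using that
      by (elim heis_basis_cases; simp add: eZ eX eX' eY even_part odd_part cross central
          del: atLeastAtMost_iff)
        (auto simp: heis_table_def heis_unit_def)
  qed
  have e_brk: "brk L x y = scl L (\<beta> x y) (e HZ)" if "x \<in> carr L" "y \<in> carr L" for x y
    using brk that by (simp add: eZ)
  have e_nz: "e HZ \<noteq> 0"
    using z by (simp add: eZ)
  have e_even_part: "e ` heis_even m \<subseteq> part L 0"
    using p q z0 by (auto simp: e_even)
  have e_odd_part: "e ` heis_odd n \<subseteq> part L 1"
    using y1 by (auto simp: e_odd)
  have e_even_span: "part L 0 \<subseteq> span (e ` heis_even m)"
  proof
    fix v assume "v \<in> part L 0"
    then obtain r where r: "r \<in> part L 0" "\<forall>w\<in>part L 0. \<beta> r w = 0"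
      and vr: "v - r \<in> span (p ` {1..m} \<union> q ` {1..m})"
      using even_span by blast
    \<comment> \<open>The radical vector is central, hence a multiple of \<open>z\<close>; this is
      how \<open>z\<close> completes the symplectic family to a spanning family of the even
      part.\<close>
    have "r \<in> span (e ` heis_even m)"
      using radical[OF r] center_span span_mono[of "{z}" "e ` heis_even m"]
      by (auto simp: e_even)
    moreover have "v - r \<in> span (e ` heis_even m)"
      using vr span_mono[of "p ` {1..m} \<union> q ` {1..m}" "e ` heis_even m"]
      by (auto simp: e_even)
    ultimately have "(v - r) + r \<in> span (e ` heis_even m)"
      by (rule span_add[rotated])
    then show "v \<in> span (e ` heis_even m)" by simp
  qed
  have e_odd_span: "part L 1 \<subseteq> span (e ` heis_odd n)"
  proof
    fix v assume "v \<in> part L 1"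
    then obtain r where r: "r \<in> part L 1" "\<forall>w\<in>part L 1. \<beta> r w = 0"
      and vr: "v - r \<in> span (y ` {1..n})"
      using odd_span by blast
    \<comment> \<open>The vector is odd, and being central it is also even.\<close>
    have "r = 0"
      using radical[OF r] r(1) center_even part_direct by auto
    with vr show "v \<in> span (e ` heis_odd n)"
      by (simp add: e_odd)
  qed
  show ?thesis
    using isomorphic_heisenberg_if_basis[OF form e_brk e_nz e_even_part e_even_span
        e_odd_part e_odd_span table] by blast
qed

end
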